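(* Let $\mathbf{B}=(B_j\in\mathbb{R}^{n_j\times n})_{j\in[m]}$ be a tuple of linear maps and let $\mathbf{p}=(p_j)_{j\in[m]}$ be a tuple of positive exponents. Let $\mathbf{p}$ be in the convex hull of $(\mathbf{1}_J)_{J\in ab_{\mathbf{B}}}$ and $\mathbf{p}=\sum_{J\in ab_{\mathbf{B}}}\lambda_J\mathbf{1}_J$ where $\sum_{J\in ab_{\mathbf{B}}}\lambda_J=1$ and $\lambda_J\ge 0$. Then $$\mathrm{BL}(\mathbf{B},\mathbf{p})\le\prod_{J\in ab_{\mathbf{B}}}\big|\det\big((B_j^T)_{j\in J}\big)\big|^{-\lambda_J}.$$
   Context: $[m]=\{1,\dots,m\}$. For $\mathbf{B}=(B_j\in\mathbb{R}^{n_j\times n})_{j\in[m]}$ and positive exponents $\mathbf{p}=(p_j)_{j\in[m]}$, $\mathrm{BL}(\mathbf{B},\mathbf{p})\in[0,\infty]$ is the optimal (smallest) constant $C$ in $$\int_{\mathbb{R}^n}\prod_{j=1}^m f_j(B_jx)^{p_j}\,dx\le C\prod_{j=1}^m\Big(\int_{\mathbb{R}^{n_j}}f_j\Big)^{p_j}$$ for all non-negative integrable $f_j:\mathbb{R}^{n_j}\to\mathbb{R}$. A set $J\subset[m]$ is a $\mathbf{B}$-admissible basis set if $\sum_{j\in J}\dim(\mathrm{Im}\,B_j^T)=\dim\big(\sum_{j\in J}\mathrm{Im}\,B_j^T\big)=n$; $ab_{\mathbf{B}}$ denotes the set of all $\mathbf{B}$-admissible basis sets. $\mathbf{1}_J\in\mathbb{R}^m$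 is the indicator vector of $J$. For $J\in ab_{\mathbf{B}}$, $(B_j^T)_{j\in J}$ is the matrix obtained by placing the blocks $B_j^T$ ($j\in J$) side by side. *)

theory Defs
  imports "HOL-Analysis.Analysis" "Jordan_Normal_Form.DL_Rank"
begin

text \<open>
  Both libraries provide vectors, matrices and determinants. Everything below uses
  \<open>Jordan_Normal_Form\<close>, whose dimensions are natural numbers, since the codomains
  of the maps \<open>B j\<close> have different dimensions.
\<close>

definition lebesgue_vec :: "nat \<Rightarrow> real Matrix.vec measure" where
  "lebesgue_vec k =
     completion (embed_measure (Pi\<^sub>M {..<k} (\<lambda>_. lborel)) (Matrix.vec k))"

lemma space_lebesgue_vec [simp]: "space (lebesgue_vec k) = carrier_vec k"
proof -
  have "v \<in> Matrix.vec k ` space (Pi\<^sub>M {..<k} (\<lambda>_. lborel))"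
    if "v \<in> carrier_vec k" for v :: "real Matrix.vec"
  proof
    show "v = Matrix.vec k (restrict (vec_index v) {..<k})"
      using that by (intro eq_vecI) auto
  qed (auto simp: space_PiM)
  then show ?thesis
    by (auto simp: lebesgue_vec_def space_embed_measure)
qed

text \<open>
  The Brascamp--Lieb constant of \<open>B 1, \<dots>, B m\<close>, where \<open>B j\<close> has \<open>n\<close> columns.
  It is the infimum of all \<open>C \<in> [0, \<infinity>]\<close> satisfying the inequality; the convention
  \<open>\<infinity> * 0 = 0\<close> only affects whether \<open>C = \<infinity>\<close> is in the set, hence not the infimum.
  Since \<open>0 powr t = 0\<close> for all \<open>t\<close>, this is meant for positive exponents.
\<close>

definition BL :: "nat \<Rightarrow> nat \<Rightarrow> (nat \<Rightarrow> real mat) \<Rightarrow> (nat \<Rightarrow> real) \<Rightarrow> ennreal" where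
  "BL n m B p = Inf {C.
     \<forall>f :: nat \<Rightarrow> real Matrix.vec \<Rightarrow> real.
       (\<forall>j\<in>{1..m}. integrable (lebesgue_vec (dim_row (B j))) (f j) \<and>
                   (\<forall>y\<in>carrier_vec (dim_row (B j)). 0 \<le> f j y)) \<longrightarrow>
       (\<integral>\<^sup>+ x. ennreal (\<Prod>j=1..m. f j (B j *\<^sub>v x) powr p j) \<partial>lebesgue_vec n)
         \<le> C * ennreal (\<Prod>j=1..m. (LINT y|lebesgue_vec (dim_row (B j)). f j y) powr p j)}"

definition mat_image :: "real mat \<Rightarrow> real Matrix.vec set" where
  "mat_image A = {A *\<^sub>v x | x. x \<in> carrier_vec (dim_col A)}"

definition subspace_sum_family ::
    "nat \<Rightarrow> nat set \<Rightarrow> (nat \<Rightarrow> real Matrix.vec set) \<Rightarrow> real Matrix.vec set" where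
  "subspace_sum_family n J W = {finsum_vec TYPE(real) n v J | v. \<forall>j\<in>J. v j \<in> W j}"

definition subspace_dimension :: "nat \<Rightarrow> real Matrix.vec set \<Rightarrow> nat" where
  "subspace_dimension n W =
     vectorspace.dim class_ring ((module_vec TYPE(real) n)\<lparr>carrier := W\<rparr>)"

definition admissible_basis_sets :: "nat \<Rightarrow> nat \<Rightarrow> (nat \<Rightarrow> real mat) \<Rightarrow> nat set set" where
  "admissible_basis_sets n m B = {J. J \<subseteq> {1..m} \<and>
     (\<Sum>j\<in>J. subspace_dimension n (mat_image (B j)\<^sup>T))
       = subspace_dimension n (subspace_sum_family n J (\<lambda>j. mat_image (B j)\<^sup>T)) \<and>
     subspace_dimension n (subspace_sum_family n J (\<lambda>j. mat_image (B j)\<^sup>T)) = n}"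

definition block_row :: "nat \<Rightarrow> (nat \<Rightarrow> real mat) \<Rightarrow> nat set \<Rightarrow> real mat" where
  "block_row n A J = mat_of_cols n (concat (map (\<lambda>j. cols (A j)) (sorted_list_of_set J)))"

text \<open>
  \<open>d\<close> to the power \<open>-t\<close> in \<open>[0, \<infinity>]\<close>, for \<open>d, t \<ge> 0\<close>; the conventions are
  \<open>0\<close> to the power \<open>0\<close> is \<open>1\<close>, and \<open>0\<close> to the power \<open>-t\<close> is \<open>\<infinity>\<close> for \<open>t > 0\<close>.
  The case \<open>d = 0\<close> matters only if some \<open>B j\<close> is not surjective: admissibility is
  expressed through ranks, so the block matrix of an admissible set may then be
  non-square, and \<^const>\<open>Determinant.det\<close> is \<open>0\<close> on non-square matrices.
  The Brascamp--Lieb constant for positive exponents is \<open>\<infinity>\<close> in that situation.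
\<close>

definition powr_neg :: "real \<Rightarrow> real \<Rightarrow> ennreal" where
  "powr_neg d t = (if t = 0 then 1 else if d = 0 then \<infinity> else ennreal (d powr (- t)))"

end

theory Submission
  imports Defs
begin

text \<open>
  Write \<open>F J x = (\<Prod>j\<in>J. f j (B j x))\<close> for a set \<open>J\<close> of indices. Since \<open>p\<close> is the combination of
  the indicator vectors of the sets \<open>J\<close> with weights \<open>\<mu> J\<close>, the integrand of the
  Brascamp--Lieb inequality is the weighted geometric mean
  \<open>\<Prod>J. F J x powr \<mu> J\<close> (\<open>prod_powr_regroup\<close>).

  Each single \<open>F J\<close> can be integrated exactly. If the square matrix with the blocks
  \<open>B j\<close> (\<open>j \<in> J\<close>) on top of each other is invertible, then the coordinates \<open>(B j x)\<close>
  are linear coordinates on the whole space, in which \<open>F J\<close> is a product of functions of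
  separate groups of variables. Changing to these coordinates and applying Tonelli gives
  \<open>\<integral>F J = (\<Prod>j\<in>J. \<integral>f j) / \<bar>det\<bar>\<close> (\<open>nn_integral_prod_block_row\<close>).

  Divide each \<open>F J\<close> by its integral. The weighted inequality of arithmetic and geometric
  means bounds the product of powers by a convex combination of functions of integral 1,
  so its integral is at most 1. This is Hoelder's inequality for several
  functions. Undoing the normalisation gives the bound, because the same regrouping of
  powers turns \<open>\<Prod>J. (\<Prod>j\<in>J. \<integral>f j) powr \<mu> J\<close> into \<open>\<Prod>j. (\<integral>f j) powr p j\<close>.

  Only the sets with \<open>\<mu> J \<noteq> 0\<close> take part. If one of them has determinant 0, the right-hand
  side is infinite and there is nothing to show; otherwise its block matrix is
  automatically square.

  The change of variables is proved by elimination: a matrix that differs from the identity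
  in one row changes one coordinate by an affine map once the others are fixed, and every
  invertible matrix becomes the identity after multiplication by finitely many such matrices.
  Functions that are only Lebesgue measurable are handled by Borel majorants
  with the same integral, which may take the value \<open>\<infinity>\<close> on a null set. Majorants at
  every point, rather than almost everywhere, can be composed with the maps \<open>B j\<close>
  without regard to preimages of null sets.
\<close>

no_notation Finite_Cartesian_Product.vec_nth (infixl "$" 90)

section \<open>Borel--Lebesgue measure on vectors\<close>

text \<open>
  Lebesgue measure restricted to the Borel sets. Its measurable functions, unlike those of
  the completion, are stable under composition with arbitrary linear maps.
\<close>
definition vec_lborel :: "nat \<Rightarrow> real Matrix.vec measure" where
  "vec_lborel n = embed_measure (Pi\<^sub>M {..<n} (\<lambda>_. lborel)) (Matrix.vec n)"

lemma lebesgue_vec_eq_completion: "lebesgue_vec n = completion (vec_lborel n)"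
  by (simp add: lebesgue_vec_def vec_lborel_def)

lemma space_vec_lborel [simp]: "space (vec_lborel n) = carrier_vec n"
  using space_lebesgue_vec[of n] by (simp add: lebesgue_vec_eq_completion)

lemma inj_on_vec: "inj_on (Matrix.vec n) (space (Pi\<^sub>M {..<n} (\<lambda>_. lborel :: real measure)))"
proof (rule inj_onI)
  fix x y :: "nat \<Rightarrow> real"
  assume xy: "x \<in> space (Pi\<^sub>M {..<n} (\<lambda>_. lborel))" "y \<in> space (Pi\<^sub>M {..<n} (\<lambda>_. lborel))"
    and eq: "Matrix.vec n x = Matrix.vec n y"
  have "x i = y i" if "i < n" for i
    using arg_cong[OF eq, of "\<lambda>v. v $ i"] that by simp
  with xy show "x = y"
    by (intro extensionalityI[of x "{..<n}" y]) (auto simp: space_PiM PiE_def)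
qed

lemma measurable_vec_index [measurable]:
  assumes "i < n"
  shows "(\<lambda>v. v $ i) \<in> borel_measurable (vec_lborel n)"
  unfolding vec_lborel_def
  by (rule measurable_embed_measure1) (use assms in simp)

lemma measurable_vec:
  assumes "\<And>i. i < n \<Longrightarrow> (\<lambda>x. h x i) \<in> borel_measurable M"
  shows "(\<lambda>x. Matrix.vec n (h x)) \<in> M \<rightarrow>\<^sub>M vec_lborel n"
proof -
  have "(\<lambda>x. \<lambda>i\<in>{..<n}. h x i) \<in> M \<rightarrow>\<^sub>M Pi\<^sub>M {..<n} (\<lambda>_. lborel)"
    by (rule measurable_restrict) (use assms in simp)
  then have "(\<lambda>x. Matrix.vec n (\<lambda>i\<in>{..<n}. h x i)) \<in> M \<rightarrow>\<^sub>M vec_lborel n"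
    unfolding vec_lborel_def
    by (rule measurable_compose) (rule measurable_embed_measure2'[OF inj_on_vec])
  also have "(\<lambda>x. Matrix.vec n (\<lambda>i\<in>{..<n}. h x i)) = (\<lambda>x. Matrix.vec n (h x))"
    by (intro ext eq_vecI) auto
  finally show ?thesis .
qed

lemma measurable_mult_mat_vec:
  assumes "A \<in> carrier_mat k n"
  shows "(\<lambda>v. A *\<^sub>v v) \<in> vec_lborel n \<rightarrow>\<^sub>M vec_lborel k"
proof -
  have "(\<lambda>v. Matrix.vec k (\<lambda>i. \<Sum>j<n. A $$ (i, j) * v $ j)) \<in> vec_lborel n \<rightarrow>\<^sub>M vec_lborel k"
    by (rule measurable_vec) simp
  also have "?this \<longleftrightarrow> ?thesis"
    by (rule measurable_cong, rule eq_vecI)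
      (use assms in \<open>auto simp: scalar_prod_def lessThan_atLeast0\<close>)
  finally show ?thesis .
qed

lemma measurable_vec_Pi [measurable]:
  "Matrix.vec n \<in> Pi\<^sub>M {..<n} (\<lambda>_. lborel) \<rightarrow>\<^sub>M vec_lborel n"
  unfolding vec_lborel_def by (rule measurable_embed_measure2'[OF inj_on_vec])

lemma nn_integral_vec_lborel:
  assumes "F \<in> borel_measurable (vec_lborel n)"
  shows "(\<integral>\<^sup>+ v. F v \<partial>vec_lborel n) = (\<integral>\<^sup>+ x. F (Matrix.vec n x) \<partial>Pi\<^sub>M {..<n} (\<lambda>_. lborel))"
  using assms unfolding vec_lborel_def by (intro nn_integral_embed_measure' inj_on_vec)

section \<open>Linear change of variables\<close>
definition row_update_mat :: "nat \<Rightarrow> nat \<Rightarrow> (nat \<Rightarrow> real) \<Rightarrow> real mat" where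
  "row_update_mat n k r = Matrix.mat n n (\<lambda>(i, j). if i = k then r j else if i = j then 1 else 0)"

lemma row_update_mat_carrier [simp]: "row_update_mat n k r \<in> carrier_mat n n"
  by (simp add: row_update_mat_def)

text \<open>
  In the Leibniz formula only the identity survives: a permutation that moves a point moves
  at least two, hence one outside row \<open>k\<close>, where the off-diagonal entries are 0.
\<close>
lemma det_row_update_mat:
  assumes "k < n"
  shows "Determinant.det (row_update_mat n k r) = r k"
proof -
  let ?R = "row_update_mat n k r"
  let ?t = "\<lambda>p. signof p * (\<Prod>i = 0..<n. ?R $$ (i, p i)) :: real"
  have zero: "?t p = 0" if p: "p permutes {0..<n}" and "p \<noteq> id" for p
  proof -
    from \<open>p \<noteq> id\<close> obtain i where i: "p i \<noteq> i" by (auto simp: fun_eq_iff)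
    have inj: "p a = p b \<longleftrightarrow> a = b" for a b using permutes_inj[OF p] by (auto dest: injD)
    obtain i where i: "p i \<noteq> i" "i \<noteq> k"
    proof (cases "i = k")
      case True
      with i inj[of "p k" k] show ?thesis by (intro that[of "p k"]) auto
    qed (use i that in auto)
    have "i < n" using i p by (meson atLeastLessThan_iff permutes_not_in zero_le)
    moreover have "p i < n" using permutes_in_image[OF p, of i] \<open>i < n\<close> by simp
    ultimately have "?R $$ (i, p i) = 0" using i by (simp add: row_update_mat_def)
    with \<open>i < n\<close> show ?thesis by (auto intro!: prod_zero)
  qed
  have "Determinant.det ?R = (\<Sum>p | p permutes {0..<n}. ?t p)"
    by (rule det_def') simp
  also have "\<dots> = (\<Sum>p \<in> {id}. ?t p)"
    by (rule sum.mono_neutral_right) (use zero in \<open>auto simp: finite_permutations permutes_id\<close>)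
  also have "\<dots> = (\<Prod>i = 0..<n. ?R $$ (i, i))" by simp
  also have "\<dots> = (\<Prod>i = 0..<n. if i = k then r k else 1)"
    by (rule prod.cong) (auto simp: row_update_mat_def)
  also have "\<dots> = r k" using assms by simp
  finally show ?thesis .
qed

definition scales_volume :: "nat \<Rightarrow> real mat \<Rightarrow> bool" where
  "scales_volume n A \<longleftrightarrow> A \<in> carrier_mat n n \<and>
     (\<forall>F \<in> borel_measurable (vec_lborel n).
        (\<integral>\<^sup>+ v. F v \<partial>vec_lborel n)
          = ennreal \<bar>Determinant.det A\<bar> * (\<integral>\<^sup>+ v. F (A *\<^sub>v v) \<partial>vec_lborel n))"

interpretation lborel_product: product_sigma_finite "\<lambda>_ :: nat. lborel :: real measure"
  by standard

text \<open>
  With all coordinates except \<open>k\<close> fixed, the map is \<open>y \<mapsto> t + r k * y\<close> in coordinate \<open>k\<close>, so the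
  claim is the one-dimensional affine substitution under the integral over the others.
\<close>
lemma scales_volume_row_update:
  assumes k: "k < n" and rk: "r k \<noteq> 0"
  shows "scales_volume n (row_update_mat n k r)"
  unfolding scales_volume_def
proof (intro conjI ballI)
  fix F :: "real Matrix.vec \<Rightarrow> ennreal"
  assume F [measurable]: "F \<in> borel_measurable (vec_lborel n)"
  let ?I = "{..<n} - {k}" and ?R = "row_update_mat n k r"
  let ?P = "\<lambda>I. Pi\<^sub>M I (\<lambda>_. lborel :: real measure)"
  define t where "t x = (\<Sum>j\<in>?I. r j * x j)" for x :: "nat \<Rightarrow> real"
  have I: "insert k ?I = {..<n}" using k by auto
  have [measurable]: "(\<lambda>v. F (?R *\<^sub>v v)) \<in> borel_measurable (vec_lborel n)"
    using measurable_mult_mat_vec[of ?R n n] F by (rule measurable_compose) simp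
  have split: "(\<integral>\<^sup>+ v. G v \<partial>vec_lborel n)
      = (\<integral>\<^sup>+ x. (\<integral>\<^sup>+ y. G (Matrix.vec n (x(k := y))) \<partial>lborel) \<partial>?P ?I)"
    if [measurable]: "G \<in> borel_measurable (vec_lborel n)" for G
    unfolding nn_integral_vec_lborel[OF that]
    by (subst (1) I[symmetric], rule lborel_product.product_nn_integral_insert)
      (use I in simp_all)
  have R: "?R *\<^sub>v Matrix.vec n (x(k := y)) = Matrix.vec n (x(k := t x + r k * y))" for x y
  proof (rule eq_vecI)
    fix i assume "i < dim_vec (Matrix.vec n (x(k := t x + r k * y)))"
    then have i: "i < n" by simp
    have "(?R *\<^sub>v Matrix.vec n (x(k := y))) $ i
        = (\<Sum>j<n. ?R $$ (i, j) * (x(k := y)) j)"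
      using i by (auto simp: scalar_prod_def lessThan_atLeast0 row_update_mat_def intro!: sum.cong)
    also have "\<dots> = (x(k := t x + r k * y)) i"
    proof (cases "i = k")
      case True
      have "(\<Sum>j<n. ?R $$ (i, j) * (x(k := y)) j) = (\<Sum>j<n. r j * (x(k := y)) j)"
        using k True by (auto simp: row_update_mat_def intro!: sum.cong)
      also have "\<dots> = r k * y + t x"
        using k by (subst sum.remove[of _ k]) (auto simp: t_def intro!: sum.cong)
      finally show ?thesis using True by simp
    next
      case False
      have "(\<Sum>j<n. ?R $$ (i, j) * (x(k := y)) j) = (\<Sum>j<n. if i = j then x i else 0)"
        by (rule sum.cong) (use i False in \<open>auto simp: row_update_mat_def\<close>)
      then show ?thesis using i False by simp
    qed
    finally show "(?R *\<^sub>v Matrix.vec n (x(k := y))) $ i = Matrix.vec n (x(k := t x + r k * y)) $ i"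
      using i by simp
  qed (simp add: row_update_mat_def)
  have upd: "(\<lambda>(x, y). Matrix.vec n (x(k := y))) \<in> ?P ?I \<Otimes>\<^sub>M lborel \<rightarrow>\<^sub>M vec_lborel n"
  proof -
    have "(\<lambda>(x, y). x(k := y)) \<in> ?P ?I \<Otimes>\<^sub>M lborel \<rightarrow>\<^sub>M ?P (insert k ?I)"
      by (rule measurable_add_dim)
    then show ?thesis
      unfolding I split_beta by measurable
  qed
  have [measurable]: "(\<lambda>y. F (Matrix.vec n (x(k := y)))) \<in> borel_measurable borel"
    if "x \<in> space (?P ?I)" for x
    using measurable_compose[OF measurable_compose[OF measurable_Pair1'[OF that] upd] F] by simp
  have [measurable]: "t \<in> borel_measurable (?P ?I)" unfolding t_def by measurable
  have "(\<lambda>(x, y). F (Matrix.vec n (x(k := t x + r k * y)))) \<in> borel_measurable (?P ?I \<Otimes>\<^sub>M lborel)"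
  proof -
    have "(\<lambda>(x, y). (x, t x + r k * y)) \<in> ?P ?I \<Otimes>\<^sub>M lborel \<rightarrow>\<^sub>M ?P ?I \<Otimes>\<^sub>M lborel"
      by measurable
    from measurable_compose[OF measurable_compose[OF this upd] F]
    show ?thesis by (simp add: split_beta)
  qed
  then have m: "(\<lambda>x. \<integral>\<^sup>+ y. F (Matrix.vec n (x(k := t x + r k * y))) \<partial>lborel) \<in> borel_measurable (?P ?I)"
    by measurable
  have "(\<integral>\<^sup>+ v. F v \<partial>vec_lborel n)
      = (\<integral>\<^sup>+ x. ennreal \<bar>r k\<bar> * (\<integral>\<^sup>+ y. F (Matrix.vec n (x(k := t x + r k * y))) \<partial>lborel) \<partial>?P ?I)"
    unfolding split[OF F]
    by (rule nn_integral_cong, rule nn_integral_real_affine[OF _ rk]) simp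
  also have "\<dots> = ennreal \<bar>r k\<bar> * (\<integral>\<^sup>+ v. F (?R *\<^sub>v v) \<partial>vec_lborel n)"
    by (subst split, simp, unfold R, rule nn_integral_cmult[OF m])
  finally show "(\<integral>\<^sup>+ v. F v \<partial>vec_lborel n)
      = ennreal \<bar>Determinant.det ?R\<bar> * (\<integral>\<^sup>+ v. F (?R *\<^sub>v v) \<partial>vec_lborel n)"
    by (simp add: det_row_update_mat k)
qed simp

text \<open>
  Multiplicativity of the determinant allows a factor to be removed without inverting it.
  This is what one step of the elimination uses.
\<close>
lemma scales_volume_cancel_right:
  assumes A: "A \<in> carrier_mat n n" and R: "scales_volume n R" and AR: "scales_volume n (A * R)"
  shows "scales_volume n A"
  unfolding scales_volume_def
proof (intro conjI ballI A)
  fix F :: "real Matrix.vec \<Rightarrow> ennreal"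
  assume F: "F \<in> borel_measurable (vec_lborel n)"
  have R': "R \<in> carrier_mat n n" using R by (simp add: scales_volume_def)
  have FA: "(\<lambda>v. F (A *\<^sub>v v)) \<in> borel_measurable (vec_lborel n)"
    using measurable_mult_mat_vec[OF A] F by (rule measurable_compose)
  have "(\<integral>\<^sup>+ v. F v \<partial>vec_lborel n)
      = ennreal \<bar>Determinant.det (A * R)\<bar> * (\<integral>\<^sup>+ v. F ((A * R) *\<^sub>v v) \<partial>vec_lborel n)"
    using AR F by (simp add: scales_volume_def)
  also have "(\<integral>\<^sup>+ v. F ((A * R) *\<^sub>v v) \<partial>vec_lborel n) = (\<integral>\<^sup>+ v. F (A *\<^sub>v (R *\<^sub>v v)) \<partial>vec_lborel n)"
    using A R' by (intro nn_integral_cong) (simp add: assoc_mult_mat_vec[of _ n n _ n])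
  also have "ennreal \<bar>Determinant.det (A * R)\<bar>
      = ennreal \<bar>Determinant.det A\<bar> * ennreal \<bar>Determinant.det R\<bar>"
    using A R' by (simp add: det_mult abs_mult ennreal_mult)
  also have "\<dots> * (\<integral>\<^sup>+ v. F (A *\<^sub>v (R *\<^sub>v v)) \<partial>vec_lborel n)
      = ennreal \<bar>Determinant.det A\<bar> * (\<integral>\<^sup>+ v. F (A *\<^sub>v v) \<partial>vec_lborel n)"
    using R FA by (simp add: scales_volume_def mult.assoc)
  finally show "(\<integral>\<^sup>+ v. F v \<partial>vec_lborel n)
      = ennreal \<bar>Determinant.det A\<bar> * (\<integral>\<^sup>+ v. F (A *\<^sub>v v) \<partial>vec_lborel n)" .
qed

lemma mult_row_update_mat_index:
  assumes A: "A \<in> carrier_mat n n" and "i < n" "j < n" "k < n"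
  shows "(A * row_update_mat n k r) $$ (i, j) = (if j = k then 0 else A $$ (i, j)) + A $$ (i, k) * r j"
proof -
  have "(A * row_update_mat n k r) $$ (i, j)
      = (\<Sum>l<n. A $$ (i, l) * (if l = k then r j else if l = j then 1 else 0))"
    using assms by (auto simp: scalar_prod_def row_update_mat_def lessThan_atLeast0 intro!: sum.cong)
  also have "\<dots> = A $$ (i, k) * r j + (\<Sum>l\<in>{..<n} - {k}. if l = j then A $$ (i, j) else 0)"
    using assms by (subst sum.remove[of _ k]) (auto intro!: arg_cong2[where f = "(+)"] sum.cong simp del: sum.delta sum.delta' split: if_splits)
  also have "(\<Sum>l\<in>{..<n} - {k}. if l = j then A $$ (i, j) else 0) = (if j = k then 0 else A $$ (i, j))"
    using assms by (subst sum.delta) auto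
  finally show ?thesis by simp
qed

text \<open>
  Column elimination, by downward induction on the number \<open>k\<close> of leading rows that already
  agree with the identity. If the pivot \<open>A $$ (k, k)\<close> is nonzero, one row update matrix on
  the right clears row \<open>k\<close>. If it is 0, some later entry of row \<open>k\<close> is nonzero, as otherwise
  row \<open>k\<close> would be a combination of the previous ones; adding that column to column \<open>k\<close> makes
  the pivot nonzero. Neither operation changes the leading rows.
\<close>
lemma scales_volume_if_unit_rows:
  assumes "k \<le> n" "A \<in> carrier_mat n n" "Determinant.det A \<noteq> 0"
    and "\<And>i j. i < k \<Longrightarrow> j < n \<Longrightarrow> A $$ (i, j) = (if i = j then 1 else 0)"
  shows "scales_volume n A"
  using assms
proof (induction k arbitrary: A rule: inc_induct)
  case base
  then have "A = 1\<^sub>m n" by (intro eq_matI) auto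
  then show ?case
    by (auto simp: scales_volume_def intro!: nn_integral_cong)
next
  case (step k)
  have pivot: "scales_volume n A"
    if A: "A \<in> carrier_mat n n" and det: "Determinant.det A \<noteq> 0"
      and rows: "\<And>i j. i < k \<Longrightarrow> j < n \<Longrightarrow> A $$ (i, j) = (if i = j then 1 else 0)"
      and nz: "A $$ (k, k) \<noteq> 0" for A
  proof -
    \<comment> \<open>This is row \<open>k\<close> of the inverse of the update by row \<open>k\<close> of \<open>A\<close>.\<close>
    define r where "r j = (if j = k then 1 else - A $$ (k, j)) / A $$ (k, k)" for j
    let ?R = "row_update_mat n k r"
    have rk: "r k \<noteq> 0" using nz by (simp add: r_def)
    have "scales_volume n (A * ?R)"
    proof (rule step.IH)
      show "Determinant.det (A * ?R) \<noteq> 0"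
        using det rk step.hyps A by (simp add: det_mult[OF A] det_row_update_mat)
      show "(A * ?R) $$ (i, j) = (if i = j then 1 else 0)" if "i < Suc k" "j < n" for i j
      proof (cases "i = k")
        case True
        then show ?thesis
          using that step.hyps A nz by (simp add: mult_row_update_mat_index r_def)
      next
        case False
        then have "i < k" using that by simp
        then show ?thesis
          using that step.hyps A rows[of i j] rows[of i k] by (auto simp: mult_row_update_mat_index)
      qed
    qed (use A in auto)
    then show ?thesis
      using scales_volume_cancel_right[OF A scales_volume_row_update] step.hyps rk by blast
  qed
  show ?case
  proof (cases "A $$ (k, k) = 0")
    case False
    then show ?thesis using pivot step.prems by blast
  next
    case True
    note A = step.prems(1)
    have "\<exists>l<n. k < l \<and> A $$ (k, l) \<noteq> 0"
    proof (rule ccontr)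
      assume no: "\<not> ?thesis"
      \<comment> \<open>The coefficients of the linear relation between row \<open>k\<close> and the unit rows above it.\<close>
      define v where "v = Matrix.vec n (\<lambda>i. if i < k then - A $$ (k, i) else if i = k then 1 else 0)"
      have "A\<^sup>T *\<^sub>v v = 0\<^sub>v n"
      proof (rule eq_vecI)
        fix j assume "j < dim_vec (0\<^sub>v n :: real Matrix.vec)"
        then have j: "j < n" by simp
        have "(A\<^sup>T *\<^sub>v v) $ j
            = (\<Sum>i<n. A $$ (i, j) * (if i < k then - A $$ (k, i) else if i = k then 1 else 0))"
          using A j by (auto simp: v_def scalar_prod_def lessThan_atLeast0 intro!: sum.cong)
        also have "\<dots> = (\<Sum>i<n. (if i = k then A $$ (k, j) else 0)
            + (if i = j then if j < k then - A $$ (k, j) else 0 else 0))"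
          using j step.prems(3) by (intro sum.cong) auto
        also have "\<dots> = A $$ (k, j) + (if j < k then - A $$ (k, j) else 0)"
          using j step.hyps by (simp add: sum.distrib)
        also have "\<dots> = 0"
        proof (cases "j < k")
          case False
          then show ?thesis using no True j by (cases "j = k") auto
        qed (use j in simp)
        finally show "(A\<^sup>T *\<^sub>v v) $ j = 0\<^sub>v n $ j" using j by simp
      qed (use A in auto)
      moreover have "v $ k \<noteq> 0\<^sub>v n $ k" using step.hyps by (simp add: v_def)
      then have "v \<noteq> 0\<^sub>v n" by auto
      ultimately have "Determinant.det A\<^sup>T = 0"
        using A by (subst det_0_iff_vec_prod_zero_field[of _ n]) (auto simp: v_def intro!: exI[of _ v])
      then show False using step.prems(2) A by (simp add: Determinant.det_transpose)
    qed
    then obtain l where l: "l < n" "k < l" "A $$ (k, l) \<noteq> 0" by blast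
    define r where "r j = (if j = k \<or> j = l then 1 else 0 :: real)" for j
    let ?R = "row_update_mat n l r"
    have AR: "(A * ?R) $$ (i, j) = A $$ (i, j) + (if j = k then A $$ (i, l) else 0)"
      if "i < n" "j < n" for i j
      using that A l by (simp add: mult_row_update_mat_index r_def)
    have "scales_volume n (A * ?R)"
    proof (rule pivot)
      show "Determinant.det (A * ?R) \<noteq> 0"
        using step.prems(2) l by (simp add: det_mult[OF A] det_row_update_mat r_def)
      show "(A * ?R) $$ (i, j) = (if i = j then 1 else 0)" if "i < k" "j < n" for i j
        using that step.hyps l step.prems(3)[of i j] step.prems(3)[of i l] by (simp add: AR)
      show "(A * ?R) $$ (k, k) \<noteq> 0"
        using True l step.hyps by (simp add: AR)
    qed (use A in auto)
    then show ?thesis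
      by (rule scales_volume_cancel_right[OF A scales_volume_row_update[OF l(1)], rotated])
        (simp add: r_def)
  qed
qed

lemma nn_integral_mult_mat_vec:
  assumes A: "A \<in> carrier_mat n n" and det: "Determinant.det A \<noteq> 0"
    and F: "F \<in> borel_measurable (vec_lborel n)"
  shows "(\<integral>\<^sup>+ v. F v \<partial>vec_lborel n)
    = ennreal \<bar>Determinant.det A\<bar> * (\<integral>\<^sup>+ v. F (A *\<^sub>v v) \<partial>vec_lborel n)"
  using scales_volume_if_unit_rows[of 0 n A] A det F by (simp add: scales_volume_def)

section \<open>Integrals of products over blocks of coordinates\<close>
lemma nn_integral_shift_coordinates:
  fixes a b :: nat
  assumes H: "H \<in> borel_measurable (Pi\<^sub>M {..<b} (\<lambda>_. lborel :: real measure))"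
  shows "(\<integral>\<^sup>+ y. H (\<lambda>i\<in>{..<b}. y (a + i)) \<partial>Pi\<^sub>M {a..<a + b} (\<lambda>_. lborel))
    = (\<integral>\<^sup>+ y. H y \<partial>Pi\<^sub>M {..<b} (\<lambda>_. lborel))"
proof -
  let ?P = "\<lambda>I. Pi\<^sub>M I (\<lambda>_. lborel :: real measure)"
  let ?s = "\<lambda>y :: nat \<Rightarrow> real. \<lambda>i\<in>{..<b}. y (a + i)"
  have s [measurable]: "?s \<in> ?P {a..<a + b} \<rightarrow>\<^sub>M ?P {..<b}"
    by (rule measurable_restrict) simp
  have "distr (?P {a..<a + b}) (?P {..<b}) ?s = ?P {..<b}"
  proof (rule lborel_product.PiM_eqI)
    fix A :: "nat \<Rightarrow> real set"
    assume A: "\<And>i. i \<in> {..<b} \<Longrightarrow> A i \<in> sets lborel"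
    have "?s -` Pi\<^sub>E {..<b} A \<inter> space (?P {a..<a + b}) = Pi\<^sub>E {a..<a + b} (\<lambda>i. A (i - a))"
    proof -
      have 1: "y \<in> Pi\<^sub>E {a..<a + b} (\<lambda>i. A (i - a))"
        if y: "y \<in> space (?P {a..<a + b})" "?s y \<in> Pi\<^sub>E {..<b} A" for y
      proof (rule PiE_I)
        fix i assume i: "i \<in> {a..<a + b}"
        with PiE_mem[OF y(2), of "i - a"] show "y i \<in> A (i - a)" by auto
      qed (use y in \<open>auto simp: space_PiM PiE_def extensional_def\<close>)
      have 2: "y \<in> space (?P {a..<a + b})" "?s y \<in> Pi\<^sub>E {..<b} A"
        if y: "y \<in> Pi\<^sub>E {a..<a + b} (\<lambda>i. A (i - a))" for y
      proof -
        show "?s y \<in> Pi\<^sub>E {..<b} A"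
        proof (rule PiE_I)
          fix i assume i: "i \<in> {..<b}"
          with PiE_mem[OF y, of "a + i"] show "?s y i \<in> A i" by simp
        qed auto
      qed (use y in \<open>auto simp: space_PiM PiE_def\<close>)
      show ?thesis
      proof (intro Set.set_eqI iffI)
        fix y assume "y \<in> ?s -` Pi\<^sub>E {..<b} A \<inter> space (?P {a..<a + b})"
        then show "y \<in> Pi\<^sub>E {a..<a + b} (\<lambda>i. A (i - a))"
          by (intro 1) (simp_all only: Int_iff vimage_eq)
      next
        fix y assume "y \<in> Pi\<^sub>E {a..<a + b} (\<lambda>i. A (i - a))"
        then show "y \<in> ?s -` Pi\<^sub>E {..<b} A \<inter> space (?P {a..<a + b})"
          using 2[of y] by (simp only: Int_iff vimage_eq)
      qed
    qed
    then have "emeasure (distr (?P {a..<a + b}) (?P {..<b}) ?s) (Pi\<^sub>E {..<b} A)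
        = emeasure (?P {a..<a + b}) (Pi\<^sub>E {a..<a + b} (\<lambda>i. A (i - a)))"
      using A by (subst emeasure_distr) (auto intro!: sets_PiM_I_finite)
    also have "\<dots> = (\<Prod>i\<in>{a..<a + b}. emeasure lborel (A (i - a)))"
      by (rule lborel_product.emeasure_PiM) (use A in auto)
    also have "\<dots> = (\<Prod>i\<in>{..<b}. emeasure lborel (A i))"
      by (rule prod.reindex_bij_witness[of _ "\<lambda>i. a + i" "\<lambda>i. i - a"]) auto
    finally show "emeasure (distr (?P {a..<a + b}) (?P {..<b}) ?s) (Pi\<^sub>E {..<b} A)
        = (\<Prod>i\<in>{..<b}. emeasure lborel (A i))" .
  qed auto
  then have "(\<integral>\<^sup>+ y. H y \<partial>?P {..<b}) = (\<integral>\<^sup>+ y. H y \<partial>distr (?P {a..<a + b}) (?P {..<b}) ?s)"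
    by simp
  also have "\<dots> = (\<integral>\<^sup>+ y. H (?s y) \<partial>?P {a..<a + b})"
    using H by (subst nn_integral_distr) auto
  finally show ?thesis by simp
qed

lemma measurable_vec_block [measurable]:
  assumes "k + b \<le> n"
  shows "(\<lambda>v. Matrix.vec b (\<lambda>i. v $ (k + i))) \<in> vec_lborel n \<rightarrow>\<^sub>M vec_lborel b"
  by (rule measurable_vec) (use assms in simp)

lemma nn_integral_vec_lborel_split:
  assumes g [measurable]: "g \<in> borel_measurable (vec_lborel a)"
    and h [measurable]: "h \<in> borel_measurable (vec_lborel b)"
  shows "(\<integral>\<^sup>+ v. g (Matrix.vec a (\<lambda>i. v $ i)) * h (Matrix.vec b (\<lambda>i. v $ (a + i))) \<partial>vec_lborel (a + b))
    = (\<integral>\<^sup>+ v. g v \<partial>vec_lborel a) * (\<integral>\<^sup>+ v. h v \<partial>vec_lborel b)"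
proof -
  let ?P = "\<lambda>I. Pi\<^sub>M I (\<lambda>_. lborel :: real measure)"
  let ?F = "\<lambda>v. g (Matrix.vec a (\<lambda>i. v $ i)) * h (Matrix.vec b (\<lambda>i. v $ (a + i)))"
  have gm: "(\<lambda>v. g (Matrix.vec a (\<lambda>i. v $ i))) \<in> borel_measurable (vec_lborel (a + b))"
    using measurable_compose[OF measurable_vec_block[of 0 a "a + b"] g] by simp
  have hm: "(\<lambda>v. h (Matrix.vec b (\<lambda>i. v $ (a + i)))) \<in> borel_measurable (vec_lborel (a + b))"
    by (rule measurable_compose[OF measurable_vec_block h]) simp
  have Fm: "?F \<in> borel_measurable (vec_lborel (a + b))" using gm hm by measurable
  have un: "{..<a + b} = {..<a} \<union> {a..<a + b}" by auto
  have "(\<integral>\<^sup>+ v. ?F v \<partial>vec_lborel (a + b)) = (\<integral>\<^sup>+ x. ?F (Matrix.vec (a + b) x) \<partial>?P {..<a + b})"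
    by (rule nn_integral_vec_lborel[OF Fm])
  also have "\<dots> = (\<integral>\<^sup>+ x. \<integral>\<^sup>+ y. ?F (Matrix.vec (a + b) (merge {..<a} {a..<a + b} (x, y)))
      \<partial>?P {a..<a + b} \<partial>?P {..<a})"
    unfolding un
  proof (rule lborel_product.product_nn_integral_fold)
    show "(\<lambda>x. ?F (Matrix.vec (a + b) x)) \<in> borel_measurable (?P ({..<a} \<union> {a..<a + b}))"
      unfolding un[symmetric] by (rule measurable_compose[OF measurable_vec_Pi Fm])
  qed auto
  also have "\<dots> = (\<integral>\<^sup>+ x. \<integral>\<^sup>+ y. g (Matrix.vec a x) * h (Matrix.vec b (\<lambda>i\<in>{..<b}. y (a + i)))
      \<partial>?P {a..<a + b} \<partial>?P {..<a})"
  proof (intro nn_integral_cong)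
    fix x y :: "nat \<Rightarrow> real"
    let ?v = "Matrix.vec (a + b) (merge {..<a} {a..<a + b} (x, y))"
    have "Matrix.vec a (\<lambda>i. ?v $ i) = Matrix.vec a x"
      by (rule eq_vecI) (auto simp: merge_def)
    moreover have "Matrix.vec b (\<lambda>i. ?v $ (a + i)) = Matrix.vec b (\<lambda>i\<in>{..<b}. y (a + i))"
      by (rule eq_vecI) (auto simp: merge_def)
    ultimately show "?F ?v = g (Matrix.vec a x) * h (Matrix.vec b (\<lambda>i\<in>{..<b}. y (a + i)))"
      by simp
  qed
  also have "\<dots> = (\<integral>\<^sup>+ x. g (Matrix.vec a x) * (\<integral>\<^sup>+ v. h v \<partial>vec_lborel b) \<partial>?P {..<a})"
  proof (rule nn_integral_cong)
    fix x
    have [measurable]: "(\<lambda>y. \<lambda>i\<in>{..<b}. y (a + i)) \<in> ?P {a..<a + b} \<rightarrow>\<^sub>M ?P {..<b}"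
      by (rule measurable_restrict) simp
    have "(\<integral>\<^sup>+ y. g (Matrix.vec a x) * h (Matrix.vec b (\<lambda>i\<in>{..<b}. y (a + i))) \<partial>?P {a..<a + b})
        = g (Matrix.vec a x) * (\<integral>\<^sup>+ y. h (Matrix.vec b (\<lambda>i\<in>{..<b}. y (a + i))) \<partial>?P {a..<a + b})"
      by (rule nn_integral_cmult) measurable
    also have "(\<integral>\<^sup>+ y. h (Matrix.vec b (\<lambda>i\<in>{..<b}. y (a + i))) \<partial>?P {a..<a + b})
        = (\<integral>\<^sup>+ v. h v \<partial>vec_lborel b)"
      unfolding nn_integral_vec_lborel[OF h]
      by (rule nn_integral_shift_coordinates) measurable
    finally show "(\<integral>\<^sup>+ y. g (Matrix.vec a x) * h (Matrix.vec b (\<lambda>i\<in>{..<b}. y (a + i))) \<partial>?P {a..<a + b})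
        = g (Matrix.vec a x) * (\<integral>\<^sup>+ v. h v \<partial>vec_lborel b)" .
  qed
  also have "\<dots> = (\<integral>\<^sup>+ v. g v \<partial>vec_lborel a) * (\<integral>\<^sup>+ v. h v \<partial>vec_lborel b)"
    unfolding nn_integral_vec_lborel[OF g] by (rule nn_integral_multc) measurable
  finally show ?thesis .
qed

text \<open>
  The value at \<open>v\<close> of the tensor product of the functions \<open>g j\<close>, where \<open>v\<close> is cut into consecutive
  blocks of lengths \<open>d j\<close>. The order of the blocks is that of the list, to match
  the order of the columns in \<^const>\<open>block_row\<close>.
\<close>
primrec block_product ::
    "(nat \<Rightarrow> nat) \<Rightarrow> (nat \<Rightarrow> real Matrix.vec \<Rightarrow> ennreal) \<Rightarrow> nat list \<Rightarrow> real Matrix.vec \<Rightarrow> ennreal" where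
  "block_product d g [] v = 1"
| "block_product d g (j # js) v = g j (Matrix.vec (d j) (\<lambda>i. v $ i))
     * block_product d g js (Matrix.vec (sum_list (map d js)) (\<lambda>i. v $ (d j + i)))"

lemma measurable_block_product:
  assumes "\<And>j. j \<in> set js \<Longrightarrow> g j \<in> borel_measurable (vec_lborel (d j))"
  shows "block_product d g js \<in> borel_measurable (vec_lborel (sum_list (map d js)))"
  using assms
proof (induction js)
  case Nil
  have "block_product d g [] = (\<lambda>_. 1)" by (rule ext) simp
  then show ?case by simp
next
  case (Cons j js)
  let ?N = "d j + sum_list (map d js)"
  have "(\<lambda>v. g j (Matrix.vec (d j) (\<lambda>i. v $ i))) \<in> borel_measurable (vec_lborel ?N)"
    using measurable_compose[OF measurable_vec_block[of 0 "d j" ?N] Cons.prems[of j]] by simp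
  moreover have "(\<lambda>v. block_product d g js (Matrix.vec (sum_list (map d js)) (\<lambda>i. v $ (d j + i))))
      \<in> borel_measurable (vec_lborel ?N)"
    by (rule measurable_compose[OF measurable_vec_block Cons.IH]) (use Cons.prems in auto)
  moreover have "block_product d g (j # js) = (\<lambda>v. g j (Matrix.vec (d j) (\<lambda>i. v $ i))
      * block_product d g js (Matrix.vec (sum_list (map d js)) (\<lambda>i. v $ (d j + i))))"
    by (rule ext) simp
  ultimately show ?case by simp
qed

lemma nn_integral_block_product:
  assumes "\<And>j. j \<in> set js \<Longrightarrow> g j \<in> borel_measurable (vec_lborel (d j))"
  shows "(\<integral>\<^sup>+ v. block_product d g js v \<partial>vec_lborel (sum_list (map d js)))
    = (\<Prod>j\<leftarrow>js. \<integral>\<^sup>+ v. g j v \<partial>vec_lborel (d j))"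
  using assms
proof (induction js)
  case Nil
  then show ?case
    by (simp add: nn_integral_vec_lborel lborel_product.nn_integral_empty del: nn_integral_const)
next
  case (Cons j js)
  then show ?case
    by (simp add: nn_integral_vec_lborel_split measurable_block_product)
qed

lemma block_product_stacked_rows:
  assumes "\<And>j. j \<in> set js \<Longrightarrow> B j \<in> carrier_mat (d j) n" and "x \<in> carrier_vec n"
  shows "block_product d g js (mat_of_rows n (concat (map (\<lambda>j. Matrix.rows (B j)) js)) *\<^sub>v x)
    = (\<Prod>j\<leftarrow>js. g j (B j *\<^sub>v x))"
  using assms(1)
proof (induction js)
  case (Cons j js)
  let ?rs = "concat (map (\<lambda>j. Matrix.rows (B j)) js)"
  let ?v = "mat_of_rows n (Matrix.rows (B j) @ ?rs) *\<^sub>v x"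
  have Bj: "B j \<in> carrier_mat (d j) n" using Cons.prems by simp
  have "set (Matrix.rows (B l)) \<subseteq> carrier_vec n" if "l \<in> set (j # js)" for l
    using rows_carrier[of "B l"] Cons.prems[OF that] by simp
  then have carr: "set (Matrix.rows (B j)) \<subseteq> carrier_vec n" "set ?rs \<subseteq> carrier_vec n"
    by auto
  have len: "length ?rs = sum_list (map d js)"
    using carrier_matD(1)[OF Cons.prems]
    by (auto simp: length_concat comp_def intro!: arg_cong[where f = sum_list])
  have "Matrix.vec (d j) (\<lambda>i. ?v $ i) = B j *\<^sub>v x"
  proof (rule eq_vecI)
    fix i assume "i < dim_vec (B j *\<^sub>v x)"
    then have i: "i < d j" using Bj by simp
    then have "(Matrix.rows (B j) @ ?rs) ! i \<in> carrier_vec n"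
      using carr(1) Bj by (auto simp: nth_append)
    then show "Matrix.vec (d j) (\<lambda>i. ?v $ i) $ i = (B j *\<^sub>v x) $ i"
      using i Bj by (simp add: mat_of_rows_row nth_append)
  qed (use Bj in simp)
  moreover have "Matrix.vec (sum_list (map d js)) (\<lambda>i. ?v $ (d j + i)) = mat_of_rows n ?rs *\<^sub>v x"
  proof (rule eq_vecI)
    fix i assume "i < dim_vec (mat_of_rows n ?rs *\<^sub>v x)"
    then have i: "i < length ?rs" by simp
    then have "?rs ! i \<in> carrier_vec n" using carr(2) by (meson nth_mem subsetD)
    then show "Matrix.vec (sum_list (map d js)) (\<lambda>i. ?v $ (d j + i)) $ i = (mat_of_rows n ?rs *\<^sub>v x) $ i"
      using i Bj by (simp add: mat_of_rows_row nth_append len[symmetric])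
  qed (simp add: len)
  ultimately show ?case using Cons by simp
qed simp

text \<open>
  The extremal case of the inequality for a single basis set: it holds with equality, for
  arbitrary \<open>g\<close>, because the maps \<open>B j\<close> together form a linear coordinate system.
\<close>
lemma nn_integral_prod_block_row:
  assumes J: "finite J"
    and B: "\<And>j. j \<in> J \<Longrightarrow> B j \<in> carrier_mat (d j) n"
    and det: "Determinant.det (block_row n (\<lambda>j. (B j)\<^sup>T) J) \<noteq> 0"
    and g: "\<And>j. j \<in> J \<Longrightarrow> g j \<in> borel_measurable (vec_lborel (d j))"
  shows "ennreal \<bar>Determinant.det (block_row n (\<lambda>j. (B j)\<^sup>T) J)\<bar>
      * (\<integral>\<^sup>+ x. (\<Prod>j\<in>J. g j (B j *\<^sub>v x)) \<partial>vec_lborel n)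
    = (\<Prod>j\<in>J. \<integral>\<^sup>+ y. g j y \<partial>vec_lborel (d j))"
proof -
  define js where "js = sorted_list_of_set J"
  have js: "set js = J" "distinct js" using J by (simp_all add: js_def)
  define rs where "rs = concat (map (\<lambda>j. Matrix.rows (B j)) js)"
  define A where "A = mat_of_rows n rs"
  have block: "block_row n (\<lambda>j. (B j)\<^sup>T) J = A\<^sup>T"
    by (simp add: block_row_def A_def transpose_mat_of_rows js_def rs_def)
  have len: "length rs = sum_list (map d js)"
    using carrier_matD(1)[OF B] js by (auto simp: rs_def length_concat comp_def intro!: arg_cong[where f = sum_list])
  \<comment> \<open>The determinant of a non-square matrix is 0 by convention, so the block matrix is square.\<close>
  have "length rs = n"
  proof (rule ccontr)
    assume "length rs \<noteq> n"
    then have "Determinant.det A\<^sup>T = 0" by (simp add: Determinant.det_def A_def)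
    then show False using det block by simp
  qed
  then have n: "sum_list (map d js) = n" using len by simp
  have A: "A \<in> carrier_mat n n"
    unfolding A_def using mat_of_rows_carrier(1)[of n rs] \<open>length rs = n\<close> by simp
  have detA: "Determinant.det A = Determinant.det (block_row n (\<lambda>j. (B j)\<^sup>T) J)"
    using A by (simp add: block Determinant.det_transpose)
  have m: "block_product d g js \<in> borel_measurable (vec_lborel n)"
    using measurable_block_product[of js g d] g js n by simp
  have "(\<Prod>j\<in>J. \<integral>\<^sup>+ y. g j y \<partial>vec_lborel (d j)) = (\<Prod>j\<leftarrow>js. \<integral>\<^sup>+ y. g j y \<partial>vec_lborel (d j))"
    using js(2) by (simp add: js(1)[symmetric] prod.distinct_set_conv_list)
  also have "\<dots> = (\<integral>\<^sup>+ v. block_product d g js v \<partial>vec_lborel n)"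
    using nn_integral_block_product[of js g d] g js n by simp
  also have "\<dots> = ennreal \<bar>Determinant.det A\<bar> * (\<integral>\<^sup>+ x. block_product d g js (A *\<^sub>v x) \<partial>vec_lborel n)"
    by (rule nn_integral_mult_mat_vec[OF A _ m]) (use det detA in simp)
  also have "(\<integral>\<^sup>+ x. block_product d g js (A *\<^sub>v x) \<partial>vec_lborel n)
      = (\<integral>\<^sup>+ x. (\<Prod>j\<in>J. g j (B j *\<^sub>v x)) \<partial>vec_lborel n)"
    using B js(2)
    by (intro nn_integral_cong)
      (simp add: A_def rs_def js(1)[symmetric] block_product_stacked_rows prod.distinct_set_conv_list)
  finally show ?thesis by (simp add: detA)
qed

section \<open>From Borel to Lebesgue measurable functions\<close>

text \<open>
  A Borel function that agrees with \<open>f\<close> almost everywhere is raised to \<open>\<infinity>\<close> on a null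
  set that contains the exceptional points. This keeps the integral and gives a bound at every point.
\<close>
lemma completion_borel_majorant:
  fixes f :: "'a \<Rightarrow> real"
  assumes f: "integrable (completion M) f" and nn: "\<And>y. y \<in> space M \<Longrightarrow> 0 \<le> f y"
  shows "\<exists>g \<in> borel_measurable M. (\<forall>y \<in> space M. ennreal (f y) \<le> g y) \<and>
    (\<integral>\<^sup>+ y. g y \<partial>M) = ennreal (LINT y|completion M. f y)"
proof -
  have "(\<lambda>y. ennreal (f y)) \<in> borel_measurable (completion M)"
    using f by simp
  from completion_ex_borel_measurable[OF this]
  obtain h where h [measurable]: "h \<in> borel_measurable M" and ae: "AE y in M. ennreal (f y) = h y"
    by auto
  obtain N where N: "N \<in> null_sets M" and fh: "\<And>y. y \<in> space M - N \<Longrightarrow> ennreal (f y) = h y"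
    using ae by (auto elim!: AE_E3)
  have [measurable]: "N \<in> sets M" using N by auto
  define g where "g y = (if y \<in> N then \<infinity> else h y)" for y
  have [measurable]: "g \<in> borel_measurable M" unfolding g_def by measurable
  have "AE y in M. g y = ennreal (f y)"
    using AE_not_in[OF N] ae by eventually_elim (simp add: g_def)
  then have "(\<integral>\<^sup>+ y. g y \<partial>M) = (\<integral>\<^sup>+ y. ennreal (f y) \<partial>M)"
    by (rule nn_integral_cong_AE)
  also have "\<dots> = (\<integral>\<^sup>+ y. ennreal (f y) \<partial>completion M)"
    by (simp add: nn_integral_completion)
  also have "\<dots> = ennreal (LINT y|completion M. f y)"
    using f nn by (intro nn_integral_eq_integral AE_I2) auto
  finally have int: "(\<integral>\<^sup>+ y. g y \<partial>M) = ennreal (LINT y|completion M. f y)" .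
  have "ennreal (f y) \<le> g y" if "y \<in> space M" for y
    using fh[of y] that by (auto simp: g_def)
  with int show ?thesis by (intro bexI[of _ g]) auto
qed

section \<open>Regrouping powers and averaging\<close>

text \<open>
  Concavity of the logarithm. A factor \<open>x i = 0\<close> of weight 0 counts as 0 in the product,
  since \<open>0 powr 0 = 0\<close>; this only makes the left-hand side smaller.
\<close>
lemma weighted_arith_geom_mean:
  fixes w x :: "'a \<Rightarrow> real"
  assumes S: "finite S" and w: "\<And>i. i \<in> S \<Longrightarrow> 0 \<le> w i" "sum w S = 1"
    and x: "\<And>i. i \<in> S \<Longrightarrow> 0 \<le> x i"
  shows "(\<Prod>i\<in>S. x i powr w i) \<le> (\<Sum>i\<in>S. w i * x i)"
proof (cases "\<exists>i\<in>S. x i = 0")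
  case True
  then have "(\<Prod>i\<in>S. x i powr w i) = 0" using S by auto
  then show ?thesis using w x by (simp add: sum_nonneg)
next
  case False
  then have pos: "0 < x i" if "i \<in> S" for i using x[OF that] that by force
  have "S \<noteq> {}" using w(2) by auto
  have mem: "(\<Sum>i\<in>S. w i *\<^sub>R x i) \<in> {0<..}"
    by (rule convex_sum[OF S]) (use w pos in auto)
  have "(\<Sum>i\<in>S. w i * ln (x i)) \<le> ln (\<Sum>i\<in>S. w i *\<^sub>R x i)"
    by (rule concave_on_sum[OF S \<open>S \<noteq> {}\<close> ln_concave]) (use w pos in auto)
  then have "exp (\<Sum>i\<in>S. w i * ln (x i)) \<le> (\<Sum>i\<in>S. w i *\<^sub>R x i)"
    using mem by (simp add: ln_ge_iff)
  also have "exp (\<Sum>i\<in>S. w i * ln (x i)) = (\<Prod>i\<in>S. x i powr w i)"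
    using False S by (auto simp: exp_sum powr_def intro!: prod.cong)
  finally show ?thesis by simp
qed

text \<open>
  Expand each exponent \<open>p j\<close> and exchange the two products. Powers of 0 do not obey the
  addition law for exponents: if some \<open>a j\<close> is 0, both sides vanish, the
  right one because \<open>j\<close> lies in some \<open>J\<close>.
\<close>
lemma prod_powr_regroup:
  fixes a p :: "'j \<Rightarrow> real" and w :: "'j set \<Rightarrow> real"
  assumes M: "finite M" and S: "finite S" "\<And>J. J \<in> S \<Longrightarrow> J \<subseteq> M"
    and p: "\<And>j. j \<in> M \<Longrightarrow> p j = (\<Sum>J\<in>S. w J * indicator J j)"
    and covered: "\<And>j. j \<in> M \<Longrightarrow> \<exists>J\<in>S. j \<in> J"
    and a: "\<And>j. j \<in> M \<Longrightarrow> 0 \<le> a j"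
  shows "(\<Prod>j\<in>M. a j powr p j) = (\<Prod>J\<in>S. (\<Prod>j\<in>J. a j) powr w J)"
proof (cases "\<exists>j\<in>M. a j = 0")
  case True
  then obtain j where j: "j \<in> M" "a j = 0" by blast
  then obtain J where J: "J \<in> S" "j \<in> J" using covered by blast
  have "(\<Prod>i\<in>J. a i) = 0" using J j S M by (auto intro!: prod_zero dest: finite_subset)
  then have "(\<Prod>J\<in>S. (\<Prod>j\<in>J. a j) powr w J) = 0" using J S by (auto intro!: prod_zero)
  moreover have "(\<Prod>j\<in>M. a j powr p j) = 0" using j M by (auto intro!: prod_zero)
  ultimately show ?thesis by simp
next
  case False
  have "(\<Prod>j\<in>M. a j powr p j) = (\<Prod>j\<in>M. \<Prod>J\<in>S. a j powr (w J * indicator J j))"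
  proof (rule prod.cong)
    fix j assume j: "j \<in> M"
    then have "a j \<noteq> 0" using False by blast
    then show "a j powr p j = (\<Prod>J\<in>S. a j powr (w J * indicator J j))"
      unfolding p[OF j] by (rule powr_sum)
  qed simp
  also have "\<dots> = (\<Prod>J\<in>S. \<Prod>j\<in>M. a j powr (w J * indicator J j))"
    by (rule prod.swap)
  also have "\<dots> = (\<Prod>J\<in>S. (\<Prod>j\<in>J. a j) powr w J)"
  proof (rule prod.cong)
    fix J assume J: "J \<in> S"
    have "(\<Prod>j\<in>M. a j powr (w J * indicator J j)) = (\<Prod>j\<in>J. a j powr w J)"
      using M S(2)[OF J] False by (intro prod.mono_neutral_cong_right) (auto simp: indicator_def)
    also have "\<dots> = (\<Prod>j\<in>J. a j) powr w J"
      using a S(2)[OF J] by (subst prod_powr_distrib) auto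
    finally show "(\<Prod>j\<in>M. a j powr (w J * indicator J j)) = (\<Prod>j\<in>J. a j) powr w J" .
  qed simp
  finally show ?thesis .
qed

lemma prod_mono_ennreal:
  fixes u v :: "'a \<Rightarrow> ennreal"
  assumes "\<And>i. i \<in> A \<Longrightarrow> u i \<le> v i"
  shows "prod u A \<le> prod v A"
  using assms by (induction A rule: infinite_finite_induct) (auto intro: mult_mono)

section \<open>The Brascamp--Lieb inequality\<close>

text \<open>
  The integrals of the products \<open>F J\<close> are bounded through their Borel majorants \<open>K J\<close>, whose
  integrals are known, and Hoelder's inequality is replaced by its proof: the
  pointwise mean inequality for the normalised functions \<open>F J x / Q J\<close>, then integration.
  Normalising requires all \<open>\<integral>f j\<close> to be positive; if one of them vanishes, then some \<open>K J\<close> has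
  integral 0, and the whole integrand is 0 wherever \<open>K J\<close> is.
\<close>
lemma brascamp_lieb_of_bases:
  fixes f :: "nat \<Rightarrow> real Matrix.vec \<Rightarrow> real"
  defines "D \<equiv> \<lambda>B n J. \<bar>Determinant.det (block_row n (\<lambda>j. (B j)\<^sup>T) J)\<bar>"
  assumes B: "\<And>j. j \<in> {1..m} \<Longrightarrow> B j \<in> carrier_mat (d j) n"
    and S: "finite S" "\<And>J. J \<in> S \<Longrightarrow> J \<subseteq> {1..m}"
    and w: "\<And>J. J \<in> S \<Longrightarrow> 0 \<le> w J" "sum w S = 1"
    and det: "\<And>J. J \<in> S \<Longrightarrow> D B n J \<noteq> 0"
    and p: "\<And>j. j \<in> {1..m} \<Longrightarrow> p j = (\<Sum>J\<in>S. w J * indicator J j)"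
    and covered: "\<And>j. j \<in> {1..m} \<Longrightarrow> \<exists>J\<in>S. j \<in> J"
    and f: "\<And>j. j \<in> {1..m} \<Longrightarrow> integrable (lebesgue_vec (d j)) (f j)"
      "\<And>j y. j \<in> {1..m} \<Longrightarrow> y \<in> carrier_vec (d j) \<Longrightarrow> 0 \<le> f j y"
  shows "(\<integral>\<^sup>+ x. ennreal (\<Prod>j=1..m. f j (B j *\<^sub>v x) powr p j) \<partial>lebesgue_vec n)
    \<le> ennreal (\<Prod>J\<in>S. D B n J powr (- w J))
      * ennreal (\<Prod>j=1..m. (LINT y|lebesgue_vec (d j). f j y) powr p j)"
proof -
  define I where "I j = (LINT y|lebesgue_vec (d j). f j y)" for j
  have I_nonneg: "0 \<le> I j" if "j \<in> {1..m}" for j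
    unfolding I_def by (rule Bochner_Integration.integral_nonneg) (use f(2) that in auto)
  have "\<exists>g \<in> borel_measurable (vec_lborel (d j)). (\<forall>y \<in> carrier_vec (d j). ennreal (f j y) \<le> g y) \<and>
      (\<integral>\<^sup>+ y. g y \<partial>vec_lborel (d j)) = ennreal (I j)" if "j \<in> {1..m}" for j
    using completion_borel_majorant[of "vec_lborel (d j)" "f j"] f[OF that]
    by (simp add: I_def lebesgue_vec_eq_completion)
  then obtain g where g: "\<And>j. j \<in> {1..m} \<Longrightarrow> g j \<in> borel_measurable (vec_lborel (d j))"
    and fg: "\<And>j y. j \<in> {1..m} \<Longrightarrow> y \<in> carrier_vec (d j) \<Longrightarrow> ennreal (f j y) \<le> g j y"
    and int_g: "\<And>j. j \<in> {1..m} \<Longrightarrow> (\<integral>\<^sup>+ y. g j y \<partial>vec_lborel (d j)) = ennreal (I j)"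
    by metis
  have finJ: "finite J" if "J \<in> S" for J using S(2)[OF that] by (rule finite_subset) simp
  define K where "K J x = (\<Prod>j\<in>J. g j (B j *\<^sub>v x))" for J x
  have K_meas: "K J \<in> borel_measurable (vec_lborel n)" if "J \<in> S" for J
    unfolding K_def
  proof (rule borel_measurable_prod_ennreal)
    fix j assume "j \<in> J"
    then have j: "j \<in> {1..m}" using S(2)[OF that] by blast
    show "(\<lambda>x. g j (B j *\<^sub>v x)) \<in> borel_measurable (vec_lborel n)"
      by (rule measurable_compose[OF measurable_mult_mat_vec[OF B[OF j]] g[OF j]])
  qed
  have int_K: "ennreal (D B n J) * (\<integral>\<^sup>+ x. K J x \<partial>vec_lborel n) = ennreal (\<Prod>j\<in>J. I j)"
    if J: "J \<in> S" for J
  proof -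
    have "ennreal (D B n J) * (\<integral>\<^sup>+ x. K J x \<partial>vec_lborel n)
        = (\<Prod>j\<in>J. \<integral>\<^sup>+ y. g j y \<partial>vec_lborel (d j))"
      unfolding D_def K_def
      by (rule nn_integral_prod_block_row) (use J S(2)[OF J] finJ B g det[OF J] in \<open>auto simp: D_def\<close>)
    also have "\<dots> = (\<Prod>j\<in>J. ennreal (I j))"
      using S(2)[OF J] by (intro prod.cong) (auto simp: int_g)
    also have "\<dots> = ennreal (\<Prod>j\<in>J. I j)"
      using S(2)[OF J] I_nonneg by (intro prod_ennreal) auto
    finally show ?thesis .
  qed
  define F where "F J x = (\<Prod>j\<in>J. f j (B j *\<^sub>v x))" for J x
  have Bx: "B j *\<^sub>v x \<in> carrier_vec (d j)" if "j \<in> {1..m}" for j x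
    by (rule carrier_vecI) (simp add: carrier_matD(1)[OF B[OF that]])
  have fBx: "0 \<le> f j (B j *\<^sub>v x)" if "j \<in> {1..m}" for j x
    using f(2)[OF that Bx[OF that]] .
  have F_nonneg: "0 \<le> F J x" if "J \<in> S" for J x
    unfolding F_def using S(2)[OF that] fBx by (intro prod_nonneg) auto
  have FK: "ennreal (F J x) \<le> K J x" if "J \<in> S" for J x
  proof -
    have "ennreal (F J x) = (\<Prod>j\<in>J. ennreal (f j (B j *\<^sub>v x)))"
      unfolding F_def using S(2)[OF that] fBx by (intro prod_ennreal[symmetric]) auto
    also have "\<dots> \<le> K J x"
      unfolding K_def using S(2)[OF that] fg Bx by (intro prod_mono_ennreal) auto
    finally show ?thesis .
  qed
  have regroup: "(\<Prod>j=1..m. f j (B j *\<^sub>v x) powr p j) = (\<Prod>J\<in>S. F J x powr w J)" for x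
    unfolding F_def by (rule prod_powr_regroup) (use S p covered fBx in auto)
  have lebesgue: "(\<integral>\<^sup>+ x. ennreal (\<Prod>j=1..m. f j (B j *\<^sub>v x) powr p j) \<partial>lebesgue_vec n)
      = (\<integral>\<^sup>+ x. ennreal (\<Prod>J\<in>S. F J x powr w J) \<partial>vec_lborel n)"
    unfolding lebesgue_vec_eq_completion nn_integral_completion regroup ..
  show ?thesis
  proof (cases "\<exists>j\<in>{1..m}. I j = 0")
    case True
    then obtain j J where j: "j \<in> {1..m}" "I j = 0" and J: "J \<in> S" "j \<in> J"
      using covered by blast
    have "(\<Prod>j\<in>J. I j) = 0" using J j finJ by (auto intro!: prod_zero)
    then have "(\<integral>\<^sup>+ x. K J x \<partial>vec_lborel n) = 0"
      using int_K[OF J(1)] det[OF J(1)] by (auto simp: D_def)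
    \<comment> \<open>The function \<open>\<infinity> * K J\<close> dominates everything that vanishes where \<open>K J\<close> does.\<close>
    then have "(\<integral>\<^sup>+ x. \<infinity> * K J x \<partial>vec_lborel n) = 0"
      by (subst nn_integral_cmult[OF K_meas[OF J(1)]]) simp
    moreover have "ennreal (\<Prod>J\<in>S. F J x powr w J) \<le> \<infinity> * K J x" for x
    proof (cases "K J x = 0")
      case True
      then have "F J x = 0" using FK[OF J(1), of x] F_nonneg[OF J(1), of x] by (simp add: ennreal_eq_0_iff)
      then have "(\<Prod>J\<in>S. F J x powr w J) = 0" using J(1) S(1) by (auto intro!: prod_zero)
      then show ?thesis by simp
    qed (simp add: ennreal_top_mult)
    ultimately have "(\<integral>\<^sup>+ x. ennreal (\<Prod>J\<in>S. F J x powr w J) \<partial>vec_lborel n) = 0"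
      using nn_integral_mono[of "vec_lborel n" "\<lambda>x. ennreal (\<Prod>J\<in>S. F J x powr w J)" "\<lambda>x. \<infinity> * K J x"]
      by simp
    then show ?thesis unfolding lebesgue by simp
  next
    case False
    then have I_pos: "0 < I j" if "j \<in> {1..m}" for j
      using I_nonneg[OF that] that by force
    define Q where "Q J = (\<Prod>j\<in>J. I j) / D B n J" for J
    have D_pos: "0 < D B n J" if "J \<in> S" for J
      using det[OF that] by (simp add: D_def)
    have IJ_pos: "0 < (\<Prod>j\<in>J. I j)" if "J \<in> S" for J
      using S(2)[OF that] I_pos by (intro prod_pos) auto
    have Q_pos: "0 < Q J" if "J \<in> S" for J
      using D_pos[OF that] IJ_pos[OF that] by (simp add: Q_def)
    have int_KQ: "(\<integral>\<^sup>+ x. K J x \<partial>vec_lborel n) = ennreal (Q J)" if J: "J \<in> S" for J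
    proof -
      have "(\<integral>\<^sup>+ x. K J x \<partial>vec_lborel n)
          = ennreal (1 / D B n J) * (ennreal (D B n J) * (\<integral>\<^sup>+ x. K J x \<partial>vec_lborel n))"
        using D_pos[OF J] by (simp add: mult.assoc[symmetric] ennreal_mult[symmetric])
      also have "\<dots> = ennreal (Q J)"
        using D_pos[OF J] IJ_pos[OF J] by (simp add: int_K[OF J] Q_def ennreal_mult[symmetric])
      finally show ?thesis .
    qed
    define W where "W = (\<Prod>J\<in>S. Q J powr w J)"
    have W_nonneg: "0 \<le> W" unfolding W_def by (intro prod_nonneg) simp
    have pointwise: "ennreal (\<Prod>J\<in>S. F J x powr w J)
        \<le> ennreal W * (\<Sum>J\<in>S. ennreal (w J / Q J) * K J x)" for x
    proof -
      have "(\<Prod>J\<in>S. F J x powr w J) = (\<Prod>J\<in>S. Q J powr w J * (F J x / Q J) powr w J)"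
      proof (rule prod.cong)
        fix J assume J: "J \<in> S"
        have "F J x = Q J * (F J x / Q J)" using Q_pos[OF J] by simp
        then show "F J x powr w J = Q J powr w J * (F J x / Q J) powr w J"
          using Q_pos[OF J] F_nonneg[OF J, of x] by (metis powr_mult)
      qed simp
      also have "\<dots> = W * (\<Prod>J\<in>S. (F J x / Q J) powr w J)"
        by (simp add: W_def prod.distrib)
      also have "\<dots> \<le> W * (\<Sum>J\<in>S. w J * (F J x / Q J))"
        using S(1) w F_nonneg Q_pos W_nonneg
        by (intro mult_left_mono weighted_arith_geom_mean) (auto simp: less_imp_le)
      finally have "ennreal (\<Prod>J\<in>S. F J x powr w J) \<le> ennreal (W * (\<Sum>J\<in>S. w J * (F J x / Q J)))"
        by (rule ennreal_leI)
      also have "\<dots> = ennreal W * (\<Sum>J\<in>S. ennreal (w J / Q J) * ennreal (F J x))"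
      proof -
        have "(\<Sum>J\<in>S. ennreal (w J / Q J) * ennreal (F J x)) = (\<Sum>J\<in>S. ennreal (w J * (F J x / Q J)))"
          using w(1) Q_pos F_nonneg
          by (intro sum.cong) (auto simp: ennreal_mult[symmetric] less_imp_le)
        also have "\<dots> = ennreal (\<Sum>J\<in>S. w J * (F J x / Q J))"
          using w(1) Q_pos F_nonneg by (intro sum_ennreal) (auto simp: less_imp_le)
        finally show ?thesis
          using W_nonneg w(1) Q_pos F_nonneg
          by (simp add: ennreal_mult sum_nonneg less_imp_le)
      qed
      also have "\<dots> \<le> ennreal W * (\<Sum>J\<in>S. ennreal (w J / Q J) * K J x)"
        by (intro mult_left_mono sum_mono FK) auto
      finally show ?thesis .
    qed
    have "(\<integral>\<^sup>+ x. ennreal (\<Prod>J\<in>S. F J x powr w J) \<partial>vec_lborel n)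
        \<le> (\<integral>\<^sup>+ x. ennreal W * (\<Sum>J\<in>S. ennreal (w J / Q J) * K J x) \<partial>vec_lborel n)"
      by (intro nn_integral_mono pointwise)
    also have "\<dots> = ennreal W * (\<Sum>J\<in>S. ennreal (w J / Q J) * (\<integral>\<^sup>+ x. K J x \<partial>vec_lborel n))"
      using K_meas by (simp add: nn_integral_cmult nn_integral_sum)
    also have "(\<Sum>J\<in>S. ennreal (w J / Q J) * (\<integral>\<^sup>+ x. K J x \<partial>vec_lborel n)) = (\<Sum>J\<in>S. ennreal (w J))"
    proof (rule sum.cong)
      fix J assume J: "J \<in> S"
      show "ennreal (w J / Q J) * (\<integral>\<^sup>+ x. K J x \<partial>vec_lborel n) = ennreal (w J)"
        using Q_pos[OF J] w(1)[OF J] by (simp add: int_KQ[OF J] ennreal_mult[symmetric])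
    qed simp
    also have "\<dots> = 1" using w by (simp add: sum_ennreal)
    finally have "(\<integral>\<^sup>+ x. ennreal (\<Prod>J\<in>S. F J x powr w J) \<partial>vec_lborel n) \<le> ennreal W" by simp
    also have "W = (\<Prod>J\<in>S. D B n J powr (- w J)) * (\<Prod>j=1..m. I j powr p j)"
    proof -
      have "W = (\<Prod>J\<in>S. D B n J powr (- w J) * (\<Prod>j\<in>J. I j) powr w J)"
        unfolding W_def using D_pos IJ_pos
        by (intro prod.cong) (simp_all add: Q_def powr_divide powr_minus less_imp_le divide_simps)
      moreover have "(\<Prod>j=1..m. I j powr p j) = (\<Prod>J\<in>S. (\<Prod>j\<in>J. I j) powr w J)"
        by (rule prod_powr_regroup) (use S p covered I_nonneg in auto)
      ultimately show ?thesis by (simp add: prod.distrib)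
    qed
    finally show ?thesis
      unfolding lebesgue I_def[symmetric] by (simp add: ennreal_mult prod_nonneg)
  qed
qed

lemma powr_neg_nonzero: "powr_neg r t \<noteq> 0"
  by (auto simp: powr_neg_def ennreal_eq_0_iff)

theorem theorem3p7:
  fixes n m :: nat
    and d :: "nat \<Rightarrow> nat"
    and B :: "nat \<Rightarrow> real mat"
    and p :: "nat \<Rightarrow> real"
    and \<mu> :: "nat set \<Rightarrow> real"
  assumes "\<And>j. j \<in> {1..m} \<Longrightarrow> B j \<in> carrier_mat (d j) n"
    and "\<And>j. j \<in> {1..m} \<Longrightarrow> 0 < p j"
    and "\<And>J. J \<in> admissible_basis_sets n m B \<Longrightarrow> 0 \<le> \<mu> J"
    and "(\<Sum>J\<in>admissible_basis_sets n m B. \<mu> J) = 1"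
    and "\<And>j. j \<in> {1..m} \<Longrightarrow>
           p j = (\<Sum>J\<in>admissible_basis_sets n m B. \<mu> J * indicator J j)"
  shows "BL n m B p
    \<le> (\<Prod>J\<in>admissible_basis_sets n m B.
         powr_neg \<bar>Determinant.det (block_row n (\<lambda>j. (B j)\<^sup>T) J)\<bar> (\<mu> J))"
proof -
  let ?ab = "admissible_basis_sets n m B"
  define D where "D J = \<bar>Determinant.det (block_row n (\<lambda>j. (B j)\<^sup>T) J)\<bar>" for J
  define S where "S = {J \<in> ?ab. \<mu> J \<noteq> 0}"
  have fin: "finite ?ab"
    by (rule finite_subset[of _ "Pow {1..m}"]) (auto simp: admissible_basis_sets_def)
  have S: "finite S" "S \<subseteq> ?ab" "\<And>J. J \<in> S \<Longrightarrow> J \<subseteq> {1..m}"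
    using fin by (auto simp: S_def admissible_basis_sets_def)
  show ?thesis
  proof (cases "\<exists>J\<in>S. D J = 0")
    case True
    then obtain J where J: "J \<in> ?ab" "\<mu> J \<noteq> 0" "D J = 0" by (auto simp: S_def)
    then have "(\<Prod>J\<in>?ab. powr_neg (D J) (\<mu> J)) = \<infinity>"
      using fin by (auto simp: ennreal_prod_eq_top powr_neg_nonzero powr_neg_def intro!: bexI[of _ J])
    then show ?thesis by (simp add: D_def)
  next
    case False
    have "(\<Prod>J\<in>?ab. powr_neg (D J) (\<mu> J)) = (\<Prod>J\<in>S. ennreal (D J powr (- \<mu> J)))"
      using False fin
      by (intro prod.mono_neutral_cong_right) (auto simp: S_def powr_neg_def)
    also have "\<dots> = ennreal (\<Prod>J\<in>S. D J powr (- \<mu> J))"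
      by (rule prod_ennreal) simp
    finally have rhs: "(\<Prod>J\<in>?ab. powr_neg (D J) (\<mu> J)) = ennreal (\<Prod>J\<in>S. D J powr (- \<mu> J))" .
    have p_S: "p j = (\<Sum>J\<in>S. \<mu> J * indicator J j)" if "j \<in> {1..m}" for j
      unfolding assms(5)[OF that]
      by (rule sum.mono_neutral_right[OF fin S(2)]) (auto simp: S_def)
    have sum_S: "sum \<mu> S = 1"
      unfolding assms(4)[symmetric]
      by (rule sum.mono_neutral_left[OF fin S(2)]) (auto simp: S_def)
    have covered: "\<exists>J\<in>S. j \<in> J" if "j \<in> {1..m}" for j
    proof (rule ccontr)
      assume "\<not> ?thesis"
      then have "p j = 0" unfolding p_S[OF that] by (intro sum.neutral) (auto simp: indicator_def)
      with assms(2)[OF that] show False by simp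
    qed
    show ?thesis
      unfolding BL_def D_def[symmetric] rhs
    proof (rule Inf_lower, rule CollectI, intro allI impI)
      fix f :: "nat \<Rightarrow> real Matrix.vec \<Rightarrow> real"
      assume f: "\<forall>j\<in>{1..m}. integrable (lebesgue_vec (dim_row (B j))) (f j) \<and>
        (\<forall>y\<in>carrier_vec (dim_row (B j)). 0 \<le> f j y)"
      have dims: "dim_row (B j) = d j" if "j \<in> {1..m}" for j using assms(1)[OF that] by auto
      have "(\<integral>\<^sup>+ x. ennreal (\<Prod>j=1..m. f j (B j *\<^sub>v x) powr p j) \<partial>lebesgue_vec n)
        \<le> ennreal (\<Prod>J\<in>S. D J powr (- \<mu> J))
          * ennreal (\<Prod>j=1..m. (LINT y|lebesgue_vec (d j). f j y) powr p j)"
        unfolding D_def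
        by (rule brascamp_lieb_of_bases)
          (use assms(1,3) S False sum_S p_S covered f dims in \<open>auto simp: D_def\<close>)
      also have "(\<Prod>j=1..m. (LINT y|lebesgue_vec (d j). f j y) powr p j)
          = (\<Prod>j=1..m. (LINT y|lebesgue_vec (dim_row (B j)). f j y) powr p j)"
        by (intro prod.cong) (auto simp: dims)
      finally show "(\<integral>\<^sup>+ x. ennreal (\<Prod>j=1..m. f j (B j *\<^sub>v x) powr p j) \<partial>lebesgue_vec n)
        \<le> ennreal (\<Prod>J\<in>S. D J powr (- \<mu> J))
          * ennreal (\<Prod>j=1..m. (LINT y|lebesgue_vec (dim_row (B j)). f j y) powr p j)" .
    qed
  qed
qed

end
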